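(* Let $\ell^\infty=\{\mathbf{y}=(y_1,y_2,\dots)\mid y_n\in\mathbb{R},\ \sup_{n\in\mathbb{N}}|y_n|<\infty\}$ with the supremum norm, let $E:\ell^\infty\to\ell^\infty$ be the shift $(E\mathbf{y})_n=y_{n+1}$, and let $A=-I+E$, where $I$ is the identity. Then $\mathbf{e}=(1,1,1,\dots)\in\ell^\infty$ is an eigenvector of $e^{tE}$ corresponding to the eigenvalue $e^t$, and for the system $\dot{\mathbf{y}}=A\mathbf{y}$, $\mathbf{y}(0)=\mathbf{y}_0\in\ell^\infty$, the trivial solution $0$ is Lyapunov stable but the system is not asymptotically stable.
   Context: The operators $e^{tE}$ and $e^{tA}$ are defined by the norm-convergent exponential series, and the solution of the system is $\mathbf{y}(t)=e^{tA}\mathbf{y}_0$. The system is asymptotically stable if $\lim_{t\to+\infty}\mathbf{y}(t)=0$ (in the norm of $\ell^\infty$) for the solution with any initial condition $\mathbf{y}_0\in\ell^\infty$. The trivial solution is Lyapunov stable if for every $\varepsilon>0$ there is $\delta>0$ such that $\|\mathbf{y}_0\|_\infty\le\delta$ implies $\|\mathbf{y}(t)\|_\infty\le\varepsilon$ for all $t\ge0$. *)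

theory Defs
  imports "HOL-Analysis.Analysis"
begin

text \<open>
  The library makes \<open>'a \<Rightarrow>\<^sub>C 'b\<close> complete only for metric domains and \<^typ>\<open>nat\<close> comes with a
  topology (the discrete one) but no metric. The metric on \<^typ>\<open>nat\<close> does not enter the norm
  of \<open>nat \<Rightarrow>\<^sub>C real\<close>.
\<close>

instantiation nat :: metric_space
begin

definition dist_nat :: "nat \<Rightarrow> nat \<Rightarrow> real"
  where "dist_nat m n = \<bar>real m - real n\<bar>"

definition uniformity_nat :: "(nat \<times> nat) filter"
  where "uniformity_nat = (INF e\<in>{0 <..}. principal {(x, y). dist x y < e})"

instance
proof
  show U: "uniformity = (INF e\<in>{0 <..}. principal {(x, y :: nat). dist x y < e})"
    by (rule uniformity_nat_def)
  have eq: "m = n" if "\<bar>real m - real n\<bar> < 1" for m n :: nat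
    using that by linarith
  have "eventually (\<lambda>(x', y). x' = x \<longrightarrow> y \<in> A) uniformity" if "x \<in> A" for x :: nat and A
  proof -
    have "eventually (\<lambda>(x', y). x' = x \<longrightarrow> y \<in> A) (principal {(x, y :: nat). dist x y < 1})"
      using that by (auto simp: eventually_principal dist_nat_def dest: eq)
    moreover have "uniformity \<le> principal {(x, y :: nat). dist x y < 1}"
      unfolding U by (rule INF_lower) simp
    ultimately show ?thesis by (rule filter_leD[rotated])
  qed
  then show "open A \<longleftrightarrow> (\<forall>x\<in>A. eventually (\<lambda>(x', y). x' = x \<longrightarrow> y \<in> A) uniformity)"
    for A :: "nat set"
    by (simp add: open_discrete)
qed (auto simp: dist_nat_def)

end

instance bcontfun :: (metric_space, banach) banach ..

text \<open>
  Since \<^typ>\<open>nat\<close> is discrete, \<open>nat \<Rightarrow>\<^sub>C real\<close> consists of all bounded real sequences, with the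
  supremum norm. The index starts at 0: the coordinate \<open>y\<^sub>n\<close>, \<open>n \<ge> 1\<close>, is the value at \<open>n - 1\<close>.
\<close>

type_synonym linf = "nat \<Rightarrow>\<^sub>C real"

lemma linf_iff_bounded: "f \<in> bcontfun \<longleftrightarrow> bounded (range f)" for f :: "nat \<Rightarrow> real"
  by (simp add: bcontfun_def)

lemma norm_linf_eq_SUP: "norm y = (SUP n. \<bar>apply_bcontfun y n\<bar>)" for y :: linf
  by (simp add: norm_bcontfun_def dist_bcontfun.rep_eq dist_real_def zero_bcontfun.rep_eq)

definition shift_seq :: "linf \<Rightarrow> linf"
  where "shift_seq y = Bcontfun (\<lambda>n. apply_bcontfun y (Suc n))"

lemma shift_seq_apply: "apply_bcontfun (shift_seq y) n = apply_bcontfun y (Suc n)"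
proof -
  have "(\<lambda>n. apply_bcontfun y (Suc n)) \<in> bcontfun"
    unfolding linf_iff_bounded by (rule bounded_subset[OF bounded_apply_bcontfun[of y]]) auto
  then show ?thesis by (simp add: shift_seq_def Bcontfun_inverse)
qed

lemma bounded_linear_shift_seq: "bounded_linear shift_seq"
proof (rule bounded_linear_intro[where K = 1])
  fix x y :: linf and r :: real
  show "shift_seq (x + y) = shift_seq x + shift_seq y"
    by (rule bcontfun_eqI) (simp add: shift_seq_apply)
  show "shift_seq (r *\<^sub>R x) = r *\<^sub>R shift_seq x"
    by (rule bcontfun_eqI) (simp add: shift_seq_apply)
  show "norm (shift_seq x) \<le> norm x * 1"
    by (rule norm_bound) (simp add: shift_seq_apply norm_bounded[of x, unfolded real_norm_def])
qed

definition shift_op :: "linf \<Rightarrow>\<^sub>L linf"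
  where "shift_op = Blinfun shift_seq"

lemma shift_op_apply: "apply_bcontfun (blinfun_apply shift_op y) n = apply_bcontfun y (Suc n)"
  by (simp add: shift_op_def bounded_linear_Blinfun_apply[OF bounded_linear_shift_seq] shift_seq_apply)

definition system_op :: "linf \<Rightarrow>\<^sub>L linf"
  where "system_op = - id_blinfun + shift_op"

primrec blinfun_power :: "('a::real_normed_vector \<Rightarrow>\<^sub>L 'a) \<Rightarrow> nat \<Rightarrow> ('a \<Rightarrow>\<^sub>L 'a)"
  where
    "blinfun_power T 0 = id_blinfun"
  | "blinfun_power T (Suc n) = T o\<^sub>L blinfun_power T n"

text \<open>
  The library's \<^const>\<open>exp\<close> needs an instance of \<^class>\<open>real_normed_algebra_1\<close>, which
  \<^typ>\<open>'a \<Rightarrow>\<^sub>L 'a\<close> is not.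
  Convergence of the series is in the operator norm.
\<close>

definition blinfun_exp :: "('a::banach \<Rightarrow>\<^sub>L 'a) \<Rightarrow> ('a \<Rightarrow>\<^sub>L 'a)"
  where "blinfun_exp T = (\<Sum>n. blinfun_power T n /\<^sub>R fact n)"

lemma norm_blinfun_power_le: "norm (blinfun_power T n) \<le> norm T ^ n"
proof (induction n)
  case 0
  then show ?case by (simp add: norm_blinfun_id_le)
next
  case (Suc n)
  have "norm (blinfun_power T (Suc n)) \<le> norm T * norm (blinfun_power T n)"
    by (simp add: norm_blinfun_compose)
  also have "\<dots> \<le> norm T * norm T ^ n"
    by (rule mult_left_mono[OF Suc]) simp
  finally show ?case by simp
qed

lemma summable_norm_blinfun_exp: "summable (\<lambda>n. norm (blinfun_power T n /\<^sub>R fact n))"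
proof (rule summable_comparison_test')
  show "summable (\<lambda>n. norm T ^ n /\<^sub>R fact n)"
    using summable_exp_generic[of "norm T"] by simp
  show "norm (norm (blinfun_power T n /\<^sub>R fact n)) \<le> norm T ^ n /\<^sub>R fact n" if "n \<ge> 0" for n
    using norm_blinfun_power_le[of T n] by (simp add: mult_left_mono)
qed

lemma blinfun_exp_sums: "(\<lambda>n. blinfun_power T n /\<^sub>R fact n) sums blinfun_exp T"
  for T :: "'a::banach \<Rightarrow>\<^sub>L 'a"
  unfolding blinfun_exp_def
  by (rule summable_sums, rule summable_norm_cancel, rule summable_norm_blinfun_exp)

definition is_eigenvector :: "('a::real_normed_vector \<Rightarrow>\<^sub>L 'a) \<Rightarrow> 'a \<Rightarrow> real \<Rightarrow> bool"
  where "is_eigenvector T v c \<longleftrightarrow> v \<noteq> 0 \<and> blinfun_apply T v = c *\<^sub>R v"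

definition solution :: "('a::banach \<Rightarrow>\<^sub>L 'a) \<Rightarrow> 'a \<Rightarrow> real \<Rightarrow> 'a"
  where "solution T y0 t = blinfun_apply (blinfun_exp (t *\<^sub>R T)) y0"

definition lyapunov_stable :: "('a::banach \<Rightarrow>\<^sub>L 'a) \<Rightarrow> bool"
  where "lyapunov_stable T \<longleftrightarrow>
    (\<forall>\<epsilon>>0. \<exists>\<delta>>0. \<forall>y0. norm y0 \<le> \<delta> \<longrightarrow> (\<forall>t\<ge>0. norm (solution T y0 t) \<le> \<epsilon>))"

definition asymptotically_stable :: "('a::banach \<Rightarrow>\<^sub>L 'a) \<Rightarrow> bool"
  where "asymptotically_stable T \<longleftrightarrow> (\<forall>y0. (solution T y0 \<longlongrightarrow> 0) at_top)"

text \<open>\<^const>\<open>solution\<close> is the unique solution of \<open>y' = T y\<close>, \<open>y 0 = y0\<close>.\<close>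

lemmas bounded_linear_blinfun_compose_left' =
  bounded_bilinear.bounded_linear_left[OF bounded_bilinear_blinfun_compose]

lemmas bounded_linear_blinfun_compose_right' =
  bounded_bilinear.bounded_linear_right[OF bounded_bilinear_blinfun_compose]

lemmas blinfun_compose_scaleR =
  bounded_bilinear.scaleR_left[OF bounded_bilinear_blinfun_compose]
  bounded_bilinear.scaleR_right[OF bounded_bilinear_blinfun_compose]

lemma blinfun_power_scaleR: "blinfun_power (t *\<^sub>R T) n = t ^ n *\<^sub>R blinfun_power T n"
  by (induction n) (simp_all add: blinfun_compose_scaleR)

lemma blinfun_power_commute: "blinfun_power T n o\<^sub>L T = T o\<^sub>L blinfun_power T n"
proof (induction n)
  case 0
  then show ?case by (auto intro: blinfun_eqI)
next
  case (Suc n)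
  then show ?case
    by (metis (no_types, lifting) blinfun_apply_blinfun_compose blinfun_eqI blinfun_power.simps(2))
qed

lemma blinfun_exp_commute: "blinfun_exp (t *\<^sub>R T) o\<^sub>L T = T o\<^sub>L blinfun_exp (t *\<^sub>R T)"
  for T :: "'a::banach \<Rightarrow>\<^sub>L 'a"
proof -
  note s = blinfun_exp_sums[of "t *\<^sub>R T"]
  have "(\<lambda>n. (blinfun_power (t *\<^sub>R T) n /\<^sub>R fact n) o\<^sub>L T) sums (blinfun_exp (t *\<^sub>R T) o\<^sub>L T)"
    by (rule bounded_linear.sums[OF bounded_linear_blinfun_compose_left' s])
  moreover have "(\<lambda>n. T o\<^sub>L (blinfun_power (t *\<^sub>R T) n /\<^sub>R fact n)) sums (T o\<^sub>L blinfun_exp (t *\<^sub>R T))"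
    by (rule bounded_linear.sums[OF bounded_linear_blinfun_compose_right' s])
  ultimately show ?thesis
    by (simp add: blinfun_power_scaleR blinfun_compose_scaleR blinfun_power_commute sums_iff)
qed

lemma blinfun_exp_zero: "blinfun_exp (0 :: 'a::banach \<Rightarrow>\<^sub>L 'a) = id_blinfun"
proof -
  have "blinfun_power (0 :: 'a \<Rightarrow>\<^sub>L 'a) n /\<^sub>R fact n = (if n = 0 then id_blinfun else 0)" for n
    by (cases n) simp_all
  then show ?thesis
    using sums_single[of 0 "\<lambda>_. id_blinfun :: 'a \<Rightarrow>\<^sub>L 'a"] by (simp add: blinfun_exp_def sums_iff)
qed

lemma blinfun_exp_has_vector_derivative:
  fixes T :: "'a::banach \<Rightarrow>\<^sub>L 'a"
  shows "((\<lambda>t. blinfun_exp (t *\<^sub>R T)) has_vector_derivative T o\<^sub>L blinfun_exp (t *\<^sub>R T)) (at t)"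
proof -
  define R where "R = \<bar>t\<bar> + 1"
  let ?S = "ball (0::real) R"
  let ?f = "\<lambda>n s. (s ^ n /\<^sub>R fact n) *\<^sub>R blinfun_power T n"
  let ?d = "\<lambda>n s. (if n = 0 then 0 else (s ^ (n - 1) /\<^sub>R fact (n - 1)) *\<^sub>R blinfun_power T n)"
  let ?g = "\<lambda>s. T o\<^sub>L blinfun_exp (s *\<^sub>R T)"
  have R: "R > 0" "t \<in> ?S" by (auto simp: R_def)
  have f: "(\<lambda>n. ?f n s) sums blinfun_exp (s *\<^sub>R T)" for s
    using blinfun_exp_sums[of "s *\<^sub>R T"] by (simp add: blinfun_power_scaleR ac_simps)
  have d: "(\<lambda>n. ?d n s) sums ?g s" for s
  proof -
    have "(\<lambda>n. T o\<^sub>L ?f n s) sums ?g s"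
      by (rule bounded_linear.sums[OF bounded_linear_blinfun_compose_right' f])
    then have "(\<lambda>n. ?d (Suc n) s) sums ?g s"
      by (simp add: blinfun_compose_scaleR)
    then show ?thesis by (subst (asm) sums_Suc_iff) simp
  qed
  have unif: "uniform_limit ?S (\<lambda>n s. \<Sum>i<n. ?d i s) (\<lambda>s. \<Sum>i. ?d i s) sequentially"
  proof (rule Weierstrass_m_test)
    let ?M = "\<lambda>n. (if n = 0 then 0 else (R ^ (n - 1) /\<^sub>R fact (n - 1)) * norm T ^ n)"
    show "norm (?d n s) \<le> ?M n" if "s \<in> ?S" for n s
    proof (cases n)
      case (Suc m)
      have "\<bar>s\<bar> ^ m \<le> R ^ m" using that by (intro power_mono) auto
      then show ?thesis
        using Suc R norm_blinfun_power_le[of T n]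
        by (auto simp: abs_mult power_abs intro!: mult_mono)
    qed simp
    have "summable (\<lambda>n. norm T * ((R * norm T) ^ n /\<^sub>R fact n))"
      by (intro summable_mult summable_exp_generic)
    then have "summable (\<lambda>n. ?M (Suc n))"
      by (simp add: power_mult_distrib mult_ac)
    then show "summable ?M" by (subst (asm) summable_Suc_iff)
  qed
  have D: "(?f n has_derivative (\<lambda>h. h *\<^sub>R ?d n s)) (at s within ?S)" for n s
  proof -
    have "((\<lambda>s. s ^ n / fact n) has_real_derivative
        (if n = 0 then 0 else s ^ (n - 1) / fact (n - 1))) (at s within ?S)"
    proof (cases n)
      case (Suc m)
      have "((\<lambda>s. s ^ Suc m / fact (Suc m)) has_real_derivative
          (1 + real m) * s ^ m / fact (Suc m)) (at s within ?S)"
        by (rule DERIV_cong[OF DERIV_cdivide[OF DERIV_power_Suc[OF DERIV_ident]]]) simp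
      moreover have "(1 + real m) * s ^ m / fact (Suc m) = s ^ m / fact m"
        by (simp add: fact_Suc del: of_nat_Suc add: of_nat_Suc[symmetric])
      ultimately show ?thesis using Suc by simp
    qed simp
    then have "((\<lambda>s. (s ^ n / fact n) *\<^sub>R blinfun_power T n) has_vector_derivative
        (if n = 0 then 0 else s ^ (n - 1) / fact (n - 1)) *\<^sub>R blinfun_power T n) (at s within ?S)"
      unfolding has_real_derivative_iff_has_vector_derivative
      by (rule bounded_linear.has_vector_derivative[OF bounded_linear_scaleR_left])
    then show ?thesis
      unfolding has_vector_derivative_def by (cases n) (simp_all add: field_simps)
  qed
  have "\<exists>g. \<forall>s\<in>?S. (\<lambda>n. ?f n s) sums g s \<and>
      (g has_derivative (\<lambda>h. h *\<^sub>R ?g s)) (at s within ?S)"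
  proof (rule has_derivative_series[where x = 0])
    show "\<forall>\<^sub>F n in sequentially. \<forall>s\<in>?S. \<forall>h.
        norm ((\<Sum>i<n. h *\<^sub>R ?d i s) - h *\<^sub>R ?g s) \<le> e * norm h" if "e > 0" for e
      using uniform_limitD[OF unif that]
    proof eventually_elim
      case (elim n)
      show ?case
      proof (intro ballI allI)
        fix s h assume "s \<in> ?S"
        have g: "(\<Sum>i. ?d i s) = ?g s" using d[of s] by (rule sums_unique[symmetric])
        have "norm ((\<Sum>i<n. ?d i s) - ?g s) \<le> e"
          using bspec[OF elim \<open>s \<in> ?S\<close>] unfolding g dist_norm by (rule less_imp_le)
        then have "\<bar>h\<bar> * norm ((\<Sum>i<n. ?d i s) - ?g s) \<le> \<bar>h\<bar> * e"
          by (rule mult_left_mono) simp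
        then show "norm ((\<Sum>i<n. h *\<^sub>R ?d i s) - h *\<^sub>R ?g s) \<le> e * norm h"
          unfolding scaleR_sum_right[symmetric] scaleR_diff_right[symmetric] norm_scaleR real_norm_def
          by (simp only: mult.commute)
      qed
    qed
  qed (use D f R in \<open>auto simp del: scaleR_scaleR\<close>)
  then obtain g where g: "\<And>s. s \<in> ?S \<Longrightarrow> (\<lambda>n. ?f n s) sums g s"
    "\<And>s. s \<in> ?S \<Longrightarrow> (g has_derivative (\<lambda>h. h *\<^sub>R ?g s)) (at s within ?S)" by blast
  have "(g has_derivative (\<lambda>h. h *\<^sub>R ?g t)) (at t)"
    using g(2)[OF R(2)] at_within_open[OF R(2)] by simp
  then have "((\<lambda>t. blinfun_exp (t *\<^sub>R T)) has_derivative (\<lambda>h. h *\<^sub>R ?g t)) (at t)"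
  proof (rule has_derivative_transform_within_open[where s = ?S])
    show "g s = blinfun_exp (s *\<^sub>R T)" if "s \<in> ?S" for s
      using g(1)[OF that] f[of s] by (rule sums_unique2)
  qed (use R in auto)
  then show ?thesis unfolding has_vector_derivative_def .
qed

lemma solution_zero: "solution T y0 0 = y0"
  by (simp add: solution_def blinfun_exp_zero)

lemma solution_has_vector_derivative:
  "(solution T y0 has_vector_derivative blinfun_apply T (solution T y0 t)) (at t)"
  using bounded_linear.has_vector_derivative[OF blinfun.bounded_linear_left
      blinfun_exp_has_vector_derivative[of T t], of y0]
  by (simp add: solution_def[abs_def])

lemma solution_unique:
  fixes T :: "'a::banach \<Rightarrow>\<^sub>L 'a"
  assumes y: "\<And>t. t \<ge> 0 \<Longrightarrow> (y has_vector_derivative blinfun_apply T (y t)) (at t within {0..})"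
    and "y 0 = y0" and "t \<ge> 0"
  shows "y t = solution T y0 t"
proof -
  define u where "u s = blinfun_apply (blinfun_exp ((t - s) *\<^sub>R T)) (y s)" for s
  have "(u has_vector_derivative 0) (at s within {0..t})" if s: "s \<in> {0..t}" for s
  proof -
    have "((\<lambda>s. t - s) has_vector_derivative -1) (at s within {0..t})"
      by (auto intro!: derivative_eq_intros)
    from vector_diff_chain_within[OF this
        has_vector_derivative_at_within[OF blinfun_exp_has_vector_derivative[of T "t - s"]]]
    have 1: "((\<lambda>s. blinfun_exp ((t - s) *\<^sub>R T)) has_vector_derivative
        - (T o\<^sub>L blinfun_exp ((t - s) *\<^sub>R T))) (at s within {0..t})"
      by (simp add: o_def)
    have 2: "(y has_vector_derivative blinfun_apply T (y s)) (at s within {0..t})"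
      using y[of s] s by (auto intro: has_vector_derivative_within_subset)
    have c: "blinfun_apply (blinfun_exp ((t - s) *\<^sub>R T)) (blinfun_apply T (y s)) =
        blinfun_apply T (blinfun_apply (blinfun_exp ((t - s) *\<^sub>R T)) (y s))"
      by (metis blinfun_exp_commute blinfun_apply_blinfun_compose)
    show ?thesis
      using bounded_bilinear.has_vector_derivative[OF bounded_bilinear_blinfun_apply 1 2]
      by (simp add: u_def[abs_def] c blinfun.minus_left)
  qed
  then have "u t = u 0"
    using has_vector_derivative_zero_constant[of "{0..t}" u] \<open>t \<ge> 0\<close>
    by (metis atLeastAtMost_iff convex_real_interval(5) order_refl)
  then show ?thesis
    using \<open>y 0 = y0\<close> by (simp add: u_def solution_def blinfun_exp_zero)
qed

end

theory Submission
  imports Defs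
begin

text \<open>
  The constant sequence \<open>e\<close> is fixed by the shift \<open>E\<close>, and the exponential of an operator carries
  each eigenvector \<open>v\<close> with eigenvalue \<open>c\<close> to an eigenvector with eigenvalue \<open>exp c\<close>
  (\<open>is_eigenvector_blinfun_exp\<close>). Applied to \<open>t E\<close> this is the first claim. Applied to
  \<open>t A\<close>, for which \<open>e\<close> has eigenvalue 0, it shows that the solution starting at \<open>e\<close> stays at \<open>e\<close>,
  so the system is not asymptotically stable.

  For Lyapunov stability, the identity commutes with everything, so the flow of \<open>A = -I + E\<close> is
  \<open>exp (- t)\<close> times the flow of \<open>E\<close> (\<open>solution_diff_id\<close>). As \<open>E\<close> has norm at most 1, the
  flow of \<open>E\<close> grows at most like \<open>exp t\<close>; the two factors cancel and the flow of \<open>A\<close> is a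
  contraction for \<open>t \<ge> 0\<close>, whence \<open>\<delta> = \<epsilon>\<close> will do.
\<close>

lemma norm_blinfun_exp_le: "norm (blinfun_exp T) \<le> exp (norm T)"
  for T :: "'a::banach \<Rightarrow>\<^sub>L 'a"
proof -
  have "norm (blinfun_exp T) \<le> (\<Sum>n. norm (blinfun_power T n /\<^sub>R fact n))"
    unfolding blinfun_exp_def by (rule summable_norm[OF summable_norm_blinfun_exp])
  also have "\<dots> \<le> (\<Sum>n. norm T ^ n /\<^sub>R fact n)"
    by (rule suminf_le[OF _ summable_norm_blinfun_exp summable_exp_generic])
      (simp add: norm_blinfun_power_le mult_left_mono)
  also have "\<dots> = exp (norm T)"
    by (simp add: exp_def)
  finally show ?thesis .
qed

lemma is_eigenvector_blinfun_exp:
  fixes T :: "'a::banach \<Rightarrow>\<^sub>L 'a"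
  assumes "is_eigenvector T v c"
  shows "is_eigenvector (blinfun_exp T) v (exp c)"
proof -
  have v: "v \<noteq> 0" "blinfun_apply T v = c *\<^sub>R v"
    using assms by (auto simp: is_eigenvector_def)
  have pow: "blinfun_apply (blinfun_power T n) v = c ^ n *\<^sub>R v" for n
    by (induction n) (simp_all add: blinfun.scaleR_right v mult.commute)
  have "(\<lambda>n. blinfun_apply (blinfun_power T n /\<^sub>R fact n) v) sums blinfun_apply (blinfun_exp T) v"
    by (rule bounded_linear.sums[OF blinfun.bounded_linear_left blinfun_exp_sums])
  moreover have "(\<lambda>n. (c ^ n /\<^sub>R fact n) *\<^sub>R v) sums (exp c *\<^sub>R v)"
    by (rule bounded_linear.sums[OF bounded_linear_scaleR_left exp_converges])
  ultimately have "blinfun_apply (blinfun_exp T) v = exp c *\<^sub>R v"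
    by (simp add: blinfun.scaleR_left pow sums_iff)
  with v show ?thesis by (simp add: is_eigenvector_def)
qed

lemma is_eigenvector_scaleR:
  assumes "is_eigenvector T v c"
  shows "is_eigenvector (t *\<^sub>R T) v (t * c)"
  using assms by (simp add: is_eigenvector_def blinfun.scaleR_left)

text \<open>
  Uniqueness of solutions replaces the functional equation \<open>exp (S + T) = exp S exp T\<close> for commuting
  operators: by the product rule, \<open>exp (- s)\<close> times the flow of \<open>T\<close> solves \<open>y' = T y - y\<close>.
\<close>

lemma solution_diff_id:
  fixes T :: "'a::banach \<Rightarrow>\<^sub>L 'a"
  assumes "t \<ge> 0"
  shows "solution (T - id_blinfun) y0 t = exp (- t) *\<^sub>R solution T y0 t"
proof (rule solution_unique[symmetric, OF _ _ assms])
  fix s :: real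
  have "((\<lambda>s. exp (- s)) has_real_derivative - exp (- s)) (at s within {0..})"
    by (auto intro!: derivative_eq_intros)
  from has_vector_derivative_scaleR[OF this
      has_vector_derivative_at_within[OF solution_has_vector_derivative[of T y0 s]]]
  show "((\<lambda>s. exp (- s) *\<^sub>R solution T y0 s) has_vector_derivative
      blinfun_apply (T - id_blinfun) (exp (- s) *\<^sub>R solution T y0 s)) (at s within {0..})"
    by (simp add: blinfun.diff_left blinfun.scaleR_right scaleR_diff_right)
qed (simp add: solution_zero)

lemma norm_shift_op_le: "norm shift_op \<le> 1"
proof (rule norm_blinfun_bound)
  show "norm (blinfun_apply shift_op y) \<le> 1 * norm y" for y
    by (rule norm_bound) (simp add: shift_op_apply norm_bounded[of y, unfolded real_norm_def])
qed simp

lemma norm_solution_system_op_le: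
  assumes "t \<ge> 0"
  shows "norm (solution system_op y0 t) \<le> norm y0"
proof -
  have "norm (blinfun_exp (t *\<^sub>R shift_op)) \<le> exp (norm (t *\<^sub>R shift_op))"
    by (rule norm_blinfun_exp_le)
  also have "\<dots> \<le> exp t"
    using mult_left_mono[OF norm_shift_op_le assms] assms by simp
  finally have "norm (solution shift_op y0 t) \<le> exp t * norm y0"
    unfolding solution_def by (rule norm_blinfun[THEN order_trans, OF mult_right_mono]) simp
  then have "exp (- t) * norm (solution shift_op y0 t) \<le> exp (- t) * (exp t * norm y0)"
    by (rule mult_left_mono) simp
  then show ?thesis
    by (simp add: system_op_def solution_diff_id[OF assms] mult.assoc[symmetric] flip: exp_add)
qed

lemma is_eigenvector_shift_op: "is_eigenvector shift_op (const_bcontfun 1) 1"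
proof -
  have "blinfun_apply shift_op (const_bcontfun 1) = const_bcontfun 1"
    by (rule bcontfun_eqI) (simp add: shift_op_apply const_bcontfun.rep_eq)
  moreover have "apply_bcontfun (const_bcontfun 1 :: linf) 0 \<noteq> apply_bcontfun 0 0"
    by (simp add: const_bcontfun.rep_eq)
  then have "(const_bcontfun 1 :: linf) \<noteq> 0"
    by metis
  ultimately show ?thesis by (simp add: is_eigenvector_def)
qed

lemma is_eigenvector_system_op: "is_eigenvector system_op (const_bcontfun 1) 0"
  using is_eigenvector_shift_op
  by (simp add: is_eigenvector_def system_op_def blinfun.diff_left)

theorem mainTheorem3:
  shows "(\<forall>t::real. is_eigenvector (blinfun_exp (t *\<^sub>R shift_op)) (const_bcontfun 1) (exp t))
    \<and> lyapunov_stable system_op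
    \<and> \<not> asymptotically_stable system_op"
proof (intro conjI allI notI)
  fix t :: real
  show "is_eigenvector (blinfun_exp (t *\<^sub>R shift_op)) (const_bcontfun 1) (exp t)"
    using is_eigenvector_blinfun_exp[OF is_eigenvector_scaleR[OF is_eigenvector_shift_op, of t]]
    by simp
next
  show "lyapunov_stable system_op"
    unfolding lyapunov_stable_def using norm_solution_system_op_le order_trans by blast
next
  let ?e = "const_bcontfun 1 :: linf"
  assume "asymptotically_stable system_op"
  then have "(solution system_op ?e \<longlongrightarrow> 0) at_top"
    by (simp add: asymptotically_stable_def)
  moreover have "solution system_op ?e t = ?e" for t
    using is_eigenvector_blinfun_exp[OF is_eigenvector_scaleR[OF is_eigenvector_system_op, of t]]
    by (simp add: is_eigenvector_def solution_def)
  then have "solution system_op ?e = (\<lambda>_. ?e)" by blast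
  ultimately have "?e = 0" by (simp add: tendsto_const_iff)
  with is_eigenvector_shift_op show False by (simp add: is_eigenvector_def)
qed

end
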